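(* Let $1\le p<\infty$. If $A\in\mathbb{C}^{m\times m}$ is nonsingular and $B\in\mathbb{C}^{m\times n}$, then $$\frac{\operatorname{sr}_p(B)}{\kappa_2(A)^p} \le \operatorname{sr}_p(AB) \le \kappa_2(A)^p\,\operatorname{sr}_p(B).$$
   Context: For $1\le p<\infty$ and $A\in\mathbb{C}^{m\times n}$ with singular values $\sigma_1(A)\ge\cdots\ge\sigma_{\min\{m,n\}}(A)\ge 0$, the Schatten $p$-norm is $\|A\|_{(p)} = \left(\sum_{j}\sigma_j(A)^p\right)^{1/p}$, and $\|A\|_2=\sigma_1(A)$ is the operator two-norm. The $p$-stable rank of a non-zero matrix $A$ is $\operatorname{sr}_p(A) = \|A\|_{(p)}^p/\|A\|_2^p$; for the zero matrix, $\operatorname{sr}_p(0)=0$. For a nonsingular square matrix $A$, $\kappa_2(A)=\|A\|_2\|A^{-1}\|_2$ is the two-norm condition number. *)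

theory Defs
  imports
    "HOL.Transcendental"
    "HOL-Computational_Algebra.Fundamental_Theorem_Algebra"
    "Jordan_Normal_Form.Schur_Decomposition"
    "Jordan_Normal_Form.Gauss_Jordan_Elimination"
begin

(* The eigenvalues of the Gram matrix are counted with algebraic multiplicity. They are real and
   nonnegative (see gram_eigenvalue_nonneg below), so that Re and sqrt lose nothing. An m x n matrix
   has min m n singular values, whereas the Gram matrix has n eigenvalues; the surplus ones are 0. *)
definition singular_values :: "complex mat \<Rightarrow> real list" where
  "singular_values A =
     take (min (dim_row A) (dim_col A))
       (rev (sorted_list_of_multiset
         (image_mset (\<lambda>e. sqrt (Re e)) (proots (char_poly (mat_adjoint A * A))))))"

(* The list is 0-based: this is the j-th largest singular value for j = 1, ..., min m n. *)
definition singular_value :: "complex mat \<Rightarrow> nat \<Rightarrow> real" where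
  "singular_value A j = singular_values A ! (j - 1)"

definition schatten_norm :: "real \<Rightarrow> complex mat \<Rightarrow> real" where
  "schatten_norm p A =
     (\<Sum>j = 1..min (dim_row A) (dim_col A). singular_value A j powr p) powr (1 / p)"

(* Unspecified for matrices without rows or columns. *)
definition two_norm :: "complex mat \<Rightarrow> real" where
  "two_norm A = singular_value A 1"

definition stable_rank :: "real \<Rightarrow> complex mat \<Rightarrow> real" where
  "stable_rank p A =
     (if A = 0\<^sub>m (dim_row A) (dim_col A) then 0
      else schatten_norm p A powr p / two_norm A powr p)"

(* Meaningful for invertible A only. *)
definition cond_number :: "complex mat \<Rightarrow> real" where
  "cond_number A = two_norm A * two_norm (the (mat_inverse A))"

lemma mat_adjoint_carrier:
  assumes "A \<in> carrier_mat m n"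
  shows "mat_adjoint A \<in> carrier_mat n m"
  using assms by (auto simp: mat_adjoint_def)

lemma mat_adjoint_index:
  assumes "i < dim_col A" "j < dim_row A"
  shows "mat_adjoint A $$ (i, j) = cnj (A $$ (j, i))"
  using assms by (simp add: mat_adjoint_def mat_of_rows_def)

lemma gram_eigenvalue_nonneg:
  assumes "eigenvalue (mat_adjoint A * A) e"
  shows "e \<in> \<real>" "0 \<le> Re e"
proof -
  define m n where "m = dim_row A" and "n = dim_col A"
  have A: "A \<in> carrier_mat m n" by (simp add: m_def n_def)
  note H = mat_adjoint_carrier[OF A]
  have dr: "dim_row (mat_adjoint A * A) = n" using H by auto
  obtain v where v: "v \<in> carrier_vec n" "v \<noteq> 0\<^sub>v n"
    and ev: "(mat_adjoint A * A) *\<^sub>v v = e \<cdot>\<^sub>v v"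
    using assms unfolding eigenvalue_def eigenvector_def dr by auto
  have w: "A *\<^sub>v v \<in> carrier_vec m" using A v by auto
  have sq: "u \<bullet>c u = complex_of_real (\<Sum>i<k. (cmod (u $ i))\<^sup>2)"
    if "u \<in> carrier_vec k" for u :: "complex vec" and k
    using that by (simp add: scalar_prod_def complex_norm_square atLeast0LessThan del: of_real_power)
  have adj: "(mat_adjoint A *\<^sub>v u) \<bullet>c v = u \<bullet>c (A *\<^sub>v v)" if u: "u \<in> carrier_vec m" for u
  proof -
    have "(mat_adjoint A *\<^sub>v u) \<bullet>c v =
        (\<Sum>i<n. (\<Sum>j<m. cnj (A $$ (j, i)) * u $ j) * cnj (v $ i))"
      using A H u v
      by (auto simp: scalar_prod_def atLeast0LessThan mat_adjoint_index intro!: sum.cong)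
    also have "\<dots> = (\<Sum>j<m. u $ j * (\<Sum>i<n. cnj (A $$ (j, i)) * cnj (v $ i)))"
      by (simp add: sum_distrib_left sum_distrib_right sum.swap[of _ "{..<n}"] mult_ac)
    also have "\<dots> = u \<bullet>c (A *\<^sub>v v)"
      using A u v by (auto simp: scalar_prod_def atLeast0LessThan intro!: sum.cong)
    finally show ?thesis .
  qed
  define a b where "a = (\<Sum>i<n. (cmod (v $ i))\<^sup>2)" and "b = (\<Sum>i<m. (cmod ((A *\<^sub>v v) $ i))\<^sup>2)"
  have "e * (v \<bullet>c v) = ((mat_adjoint A * A) *\<^sub>v v) \<bullet>c v"
    unfolding ev using v by simp
  also have "(mat_adjoint A * A) *\<^sub>v v = mat_adjoint A *\<^sub>v (A *\<^sub>v v)"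
    by (rule assoc_mult_mat_vec[OF H A v(1)])
  finally have "e * complex_of_real a = complex_of_real b"
    by (simp only: adj[OF w] sq[OF w] sq[OF v(1)] a_def b_def)
  moreover have "a > 0"
  proof -
    obtain i where "i < n" "v $ i \<noteq> 0" using v by (metis carrier_vecD eq_vecI index_zero_vec)
    then show ?thesis unfolding a_def by (intro sum_pos2[of _ i]) auto
  qed
  ultimately have "e = complex_of_real (b / a)" by (simp add: field_simps)
  moreover have "b / a \<ge> 0" using \<open>a > 0\<close> by (simp add: b_def sum_nonneg)
  ultimately show "e \<in> \<real>" "0 \<le> Re e" by (auto simp del: of_real_divide)
qed

lemma length_singular_values: "length (singular_values A) = min (dim_row A) (dim_col A)"
proof -
  have "mat_adjoint A * A \<in> carrier_mat (dim_col A) (dim_col A)"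
    using mat_adjoint_carrier[of A "dim_row A" "dim_col A"] by auto
  from degree_monic_char_poly[OF this] have "degree (char_poly (mat_adjoint A * A)) = dim_col A" ..
  moreover have "length (sorted_list_of_multiset M) = size M" for M :: "real multiset"
    by (metis mset_sorted_list_of_multiset size_mset)
  ultimately show ?thesis
    by (simp add: singular_values_def size_proots_complex)
qed

end

theory Submission
  imports Defs
begin

text \<open>Each singular value satisfies \<open>\<sigma>\<^sub>j(AB) \<le> \<parallel>A\<parallel>\<^sub>2 \<sigma>\<^sub>j(B)\<close>: the top \<open>j\<close> right singular vectors of \<open>AB\<close>
  and the bottom \<open>n - j + 1\<close> ones of \<open>B\<close> span subspaces with a common non-zero vector \<open>x\<close>, and
  \<open>\<sigma>\<^sub>j(AB) \<parallel>x\<parallel> \<le> \<parallel>ABx\<parallel> \<le> \<parallel>A\<parallel>\<^sub>2 \<parallel>Bx\<parallel> \<le> \<parallel>A\<parallel>\<^sub>2 \<sigma>\<^sub>j(B) \<parallel>x\<parallel>\<close>. This bounds the numerator of \<open>sr\<^sub>p(AB)\<close> from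
  above; the same inequality for \<open>B = A\<^sup>-\<^sup>1(AB)\<close> and \<open>j = 1\<close> bounds its denominator from below. Since
  \<open>A\<close> and \<open>A\<^sup>-\<^sup>1\<close> have the same condition number, the lower bound is the upper bound for
  \<open>A\<^sup>-\<^sup>1\<close> applied to \<open>AB\<close>.\<close>

section \<open>Squared norms and adjoints\<close>

definition sq_vnorm :: "complex vec \<Rightarrow> real" where
  "sq_vnorm v = (\<Sum>i<dim_vec v. (cmod (v $ i))\<^sup>2)"

lemma sq_vnorm_carrier: "v \<in> carrier_vec n \<Longrightarrow> sq_vnorm v = (\<Sum>i<n. (cmod (v $ i))\<^sup>2)"
  by (auto simp: sq_vnorm_def)

lemma cscalar_prod_self:
  fixes v :: "complex vec"
  shows "v \<bullet>c v = complex_of_real (sq_vnorm v)"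
  by (simp add: sq_vnorm_def scalar_prod_def complex_norm_square atLeast0LessThan
      del: of_real_power)

lemma sq_vnorm_nonneg: "0 \<le> sq_vnorm v"
  by (simp add: sq_vnorm_def sum_nonneg)

lemma sq_vnorm_eq_0:
  assumes "v \<in> carrier_vec n"
  shows "sq_vnorm v = 0 \<longleftrightarrow> v = 0\<^sub>v n"
  using assms by (auto simp: sq_vnorm_def sum_nonneg_eq_0_iff)

lemma sq_vnorm_pos:
  assumes "v \<in> carrier_vec n" "v \<noteq> 0\<^sub>v n"
  shows "0 < sq_vnorm v"
  using sq_vnorm_nonneg[of v] sq_vnorm_eq_0[OF assms(1)] assms(2) by linarith

lemma mat_adjoint_mult_vec_cscalar_prod:
  fixes A :: "complex mat"
  assumes A: "A \<in> carrier_mat m n" and u: "u \<in> carrier_vec m" and v: "v \<in> carrier_vec n"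
  shows "(mat_adjoint A *\<^sub>v u) \<bullet>c v = u \<bullet>c (A *\<^sub>v v)"
proof -
  note H = mat_adjoint_carrier[OF A]
  have "(mat_adjoint A *\<^sub>v u) \<bullet>c v =
      (\<Sum>i<n. (\<Sum>j<m. cnj (A $$ (j, i)) * u $ j) * cnj (v $ i))"
    using A H u v
    by (auto simp: scalar_prod_def atLeast0LessThan mat_adjoint_index intro!: sum.cong)
  also have "\<dots> = (\<Sum>j<m. u $ j * (\<Sum>i<n. cnj (A $$ (j, i)) * cnj (v $ i)))"
    by (simp add: sum_distrib_left sum_distrib_right sum.swap[of _ "{..<n}"] mult_ac)
  also have "\<dots> = u \<bullet>c (A *\<^sub>v v)"
    using A u v by (auto simp: scalar_prod_def atLeast0LessThan intro!: sum.cong)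
  finally show ?thesis .
qed

lemma mat_adjoint_mult:
  fixes A B :: "complex mat"
  assumes A: "A \<in> carrier_mat m n" and B: "B \<in> carrier_mat n k"
  shows "mat_adjoint (A * B) = mat_adjoint B * mat_adjoint A"
proof (rule eq_matI)
  note H = mat_adjoint_carrier[OF A] mat_adjoint_carrier[OF B] mat_adjoint_carrier[of "A * B" m k]
  show "dim_row (mat_adjoint (A * B)) = dim_row (mat_adjoint B * mat_adjoint A)"
    "dim_col (mat_adjoint (A * B)) = dim_col (mat_adjoint B * mat_adjoint A)"
    using A B H by auto
  fix i j assume "i < dim_row (mat_adjoint B * mat_adjoint A)"
    and "j < dim_col (mat_adjoint B * mat_adjoint A)"
  then show "mat_adjoint (A * B) $$ (i, j) = (mat_adjoint B * mat_adjoint A) $$ (i, j)"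
    using A B H by (auto simp: mat_adjoint_index scalar_prod_def mult.commute)
qed

lemma mat_adjoint_adjoint: "mat_adjoint (mat_adjoint A) = A" for A :: "complex mat"
proof -
  have "mat_adjoint A \<in> carrier_mat (dim_col A) (dim_row A)"
    by (rule mat_adjoint_carrier) auto
  from mat_adjoint_carrier[OF this] this show ?thesis
    by (intro eq_matI) (auto simp: mat_adjoint_index)
qed

section \<open>Unitary diagonalization of Hermitian matrices\<close>

lemma mat_adjoint_one_direct_sum:
  fixes U :: "complex mat"
  assumes U: "U \<in> carrier_mat n n"
  shows "mat_adjoint (four_block_mat (1\<^sub>m 1) (0\<^sub>m 1 n) (0\<^sub>m n 1) U) =
    four_block_mat (1\<^sub>m 1) (0\<^sub>m 1 n) (0\<^sub>m n 1) (mat_adjoint U)"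
proof -
  let ?X = "four_block_mat (1\<^sub>m 1) (0\<^sub>m 1 n) (0\<^sub>m n 1) U"
  have "mat_adjoint ?X \<in> carrier_mat (1 + n) (1 + n)"
    using U by (intro mat_adjoint_carrier) auto
  with U mat_adjoint_carrier[OF U] show ?thesis
    by (intro eq_matI) (auto simp: mat_adjoint_index)
qed

text \<open>Complete \<open>v\<close> to a basis and orthogonalize, which keeps the first vector;
  dividing by the lengths makes the columns orthonormal. Only the direction of the first column
  matters later, so the scalar \<open>c\<close> stays unspecified.\<close>

lemma unitary_first_column:
  fixes v :: "complex vec"
  assumes v: "v \<in> carrier_vec n" "v \<noteq> 0\<^sub>v n"
  obtains W c where "W \<in> carrier_mat n n" "mat_adjoint W * W = 1\<^sub>m n" "col W 0 = c \<cdot>\<^sub>v v"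
proof -
  interpret cof_vec_space n "TYPE(complex)" .
  have n: "0 < n"
    using v by (cases n) auto
  define ws where "ws = gram_schmidt n (basis_completion v)"
  note bc = basis_completion[OF v]
  note gs = gram_schmidt_result[OF bc(2,4,5) ws_def]
  have len: "length ws = n"
    using gs(4) bc(6) by simp
  have "hd ws = v"
    by (metis bc(2,6,7) gram_schmidt_hd list.exhaust list.sel(1) list.size(3) n nat_less_le ws_def v(1))
  then have ws0: "ws ! 0 = v"
    using len n by (metis hd_conv_nth list.size(3) nat_less_le)
  have wsc: "ws ! j \<in> carrier_vec n" if "j < n" for j
    using gs(3) that len by auto
  have orth: "(ws ! i \<bullet>c ws ! j = 0) = (i \<noteq> j)" if "i < n" "j < n" for i j
    using corthogonalD[OF gs(2)] that len by auto
  \<comment> \<open>\<open>gram_schmidt\<close> guarantees orthogonality only; \<open>r j\<close> is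
    the length by which the \<open>j\<close>-th vector is normalized.\<close>
  define r where "r j = complex_of_real (sqrt (sq_vnorm (ws ! j)))" for j
  have rr: "r j * r j = ws ! j \<bullet>c ws ! j" "r j \<noteq> 0" "cnj (r j) = r j" if "j < n" for j
    using orth[OF that that] sq_vnorm_nonneg[of "ws ! j"]
    by (simp_all add: r_def cscalar_prod_self flip: of_real_mult)
  define W where "W = mat n n (\<lambda>(i, j). ws ! j $ i / r j)"
  have W: "W \<in> carrier_mat n n"
    by (simp add: W_def)
  note H = mat_adjoint_carrier[OF W]
  have "mat_adjoint W * W = 1\<^sub>m n"
  proof (rule eq_matI)
    fix i j assume "i < dim_row (1\<^sub>m n)" "j < dim_col (1\<^sub>m n)"
    then have ij: "i < n" "j < n" by auto
    have "(mat_adjoint W * W) $$ (i, j) =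
        (\<Sum>k = 0..<n. cnj (ws ! i $ k / r i) * (ws ! j $ k / r j))"
      using ij W H by (simp add: scalar_prod_def mat_adjoint_index) (simp add: W_def)
    also have "\<dots> = (ws ! j \<bullet>c ws ! i) / (r i * r j)"
      using ij rr wsc[of i] wsc[of j]
      by (simp add: scalar_prod_def sum_divide_distrib mult.commute)
    also have "\<dots> = 1\<^sub>m n $$ (i, j)"
      using ij orth[of j i] rr[of i] by (cases "i = j") auto
    finally show "(mat_adjoint W * W) $$ (i, j) = 1\<^sub>m n $$ (i, j)" .
  qed (use W H in auto)
  moreover have "col W 0 = (1 / r 0) \<cdot>\<^sub>v v"
    using n v(1) by (intro eq_vecI) (auto simp: W_def ws0)
  ultimately show ?thesis
    using that W by blast
qed

text \<open>For square matrices a left inverse is also a right inverse, so the adjoint of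
  \<open>W\<close> is its inverse. This carries the characteristic polynomial through the change of
  basis below.\<close>

lemma similar_mat_adjoint_conj:
  fixes A W :: "complex mat"
  assumes A: "A \<in> carrier_mat n n" and W: "W \<in> carrier_mat n n" "mat_adjoint W * W = 1\<^sub>m n"
  shows "similar_mat (mat_adjoint W * A * W) A"
proof -
  note H = mat_adjoint_carrier[OF W(1)]
  have "similar_mat_wit (mat_adjoint W * A * W) A (mat_adjoint W) W"
    using A W H mat_mult_left_right_inverse[OF H W(1,2)] by (intro similar_mat_witI[of _ _ n]) auto
  then show ?thesis
    unfolding similar_mat_def by blast
qed

text \<open>Deflation, by induction on the eigenvalue list: a unitary matrix whose first column is
  an eigenvector splits off \<open>e\<close> and leaves a smaller Hermitian block. Prescribing the
  list \<open>es\<close> also prescribes the order on the diagonal, which is later that of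
  \<open>gram_spectrum\<close>.\<close>

lemma hermitian_diagonalization:
  fixes A :: "complex mat"
  assumes "A \<in> carrier_mat n n" "mat_adjoint A = A"
    and "char_poly A = (\<Prod>e\<leftarrow>es. [:- e, 1:])" "length es = n"
  shows "\<exists>U \<in> carrier_mat n n. mat_adjoint U * U = 1\<^sub>m n \<and>
    mat_adjoint U * A * U = mat_diag n (\<lambda>i. es ! i)"
  using assms
proof (induction es arbitrary: n A)
  case Nil
  then show ?case
    using mat_adjoint_carrier[of "1\<^sub>m 0 :: complex mat" 0 0]
    by (intro bexI[of _ "1\<^sub>m 0"] conjI eq_matI) (auto simp: mat_diag_def)
next
  case (Cons e es)
  define k where "k = length es"
  have n: "n = Suc k"
    using Cons.prems(4) by (simp add: k_def)
  note A = Cons.prems(1)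
  have "eigenvalue A e"
    using Cons.prems by (simp add: eigenvalue_root_char_poly[OF A])
  then obtain v where v: "v \<in> carrier_vec n" "v \<noteq> 0\<^sub>v n" and ev: "A *\<^sub>v v = e \<cdot>\<^sub>v v"
    using A unfolding eigenvalue_def eigenvector_def by auto
  from unitary_first_column[OF v] obtain W c where W: "W \<in> carrier_mat n n"
    and WW: "mat_adjoint W * W = 1\<^sub>m n" and col0: "col W 0 = c \<cdot>\<^sub>v v"
    by blast
  note H = mat_adjoint_carrier[OF W]
  define A' where "A' = mat_adjoint W * A * W"
  have A': "A' \<in> carrier_mat n n"
    using A W H by (auto simp: A'_def)
  have adjA': "mat_adjoint A' = A'"
  proof -
    have "mat_adjoint A' = mat_adjoint W * (mat_adjoint A * mat_adjoint (mat_adjoint W))"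
      using A W H mat_adjoint_carrier[OF A] unfolding A'_def
      by (simp add: mat_adjoint_mult[of _ n n _ n] mat_adjoint_adjoint
          assoc_mult_mat[of _ n n _ n _ n])
    also have "\<dots> = A'"
      using A W H Cons.prems(2) by (simp add: mat_adjoint_adjoint A'_def assoc_mult_mat[of _ n n _ n _ n])
    finally show ?thesis .
  qed
  have n0: "0 < n"
    by (simp add: n)
  have AW: "A * W \<in> carrier_mat n n"
    using A W by auto
  \<comment> \<open>The first column of \<open>W\<close> is an eigenvector for \<open>e\<close>, and
    \<open>mat_adjoint W\<close> sends it to the first unit vector.\<close>
  have "col A' 0 = mat_adjoint W *\<^sub>v (A *\<^sub>v col W 0)"
    unfolding A'_def assoc_mult_mat[OF H A W] col_mult2[OF H AW n0] col_mult2[OF A W n0] ..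
  also have "A *\<^sub>v col W 0 = e \<cdot>\<^sub>v col W 0"
    using A v by (simp add: col0 mult_mat_vec[of _ n n] ev smult_smult_assoc mult.commute)
  also have "mat_adjoint W *\<^sub>v \<dots> = e \<cdot>\<^sub>v col (mat_adjoint W * W) 0"
    unfolding col_mult2[OF H W n0] by (rule mult_mat_vec[OF H col_carrier_vec[OF n0 W]])
  finally have c0: "col A' 0 = e \<cdot>\<^sub>v unit_vec n 0"
    using n by (simp add: WW)
  have A'0: "A' $$ (i, 0) = (if i = 0 then e else 0)" if "i < n" for i
    using arg_cong[OF c0, of "\<lambda>w. w $ i"] that A' n by auto
  \<comment> \<open>Hermitian symmetry carries the zeros of the first column over to the first
    row.\<close>
  have A'0': "A' $$ (0, i) = (if i = 0 then e else 0)" if "i < n" for i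
    using A'0[OF that] mat_adjoint_index[of 0 A' i] mat_adjoint_index[of i A' 0]
      A' that n adjA' A'0[of 0] by auto
  define A3 where "A3 = mat k k (\<lambda>(i, j). A' $$ (Suc i, Suc j))"
  have A3: "A3 \<in> carrier_mat k k"
    by (simp add: A3_def)
  define E where "E = mat 1 1 (\<lambda>_. e)"
  have E: "E \<in> carrier_mat 1 1"
    by (simp add: E_def)
  have blk: "A' = four_block_mat E (0\<^sub>m 1 k) (0\<^sub>m k 1) A3"
  proof (rule eq_matI)
    fix i j assume "i < dim_row (four_block_mat E (0\<^sub>m 1 k) (0\<^sub>m k 1) A3)"
      "j < dim_col (four_block_mat E (0\<^sub>m 1 k) (0\<^sub>m k 1) A3)"
    then have "i < n" "j < n"
      using E A3 n by auto
    then show "A' $$ (i, j) = four_block_mat E (0\<^sub>m 1 k) (0\<^sub>m k 1) A3 $$ (i, j)"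
      using A'0 A'0' n by (cases i; cases j) (auto simp: E_def A3_def)
  qed (use A' E A3 n in auto)
  have adjA3: "mat_adjoint A3 = A3"
  proof (rule eq_matI)
    fix i j assume "i < dim_row A3" "j < dim_col A3"
    then have ij: "i < k" "j < k" using A3 by auto
    then have "cnj (A' $$ (Suc j, Suc i)) = A' $$ (Suc i, Suc j)"
      using mat_adjoint_index[of "Suc i" A' "Suc j"] A' n adjA' by auto
    with ij A3 show "mat_adjoint A3 $$ (i, j) = A3 $$ (i, j)"
      by (simp add: mat_adjoint_index) (simp add: A3_def)
  qed (use mat_adjoint_carrier[OF A3] A3 in auto)
  have "char_poly E = [:- e, 1:]"
    by (simp add: E_def char_poly_defs det_def sign_def)
  moreover have "char_poly A' = char_poly E * char_poly A3"
    unfolding blk by (rule char_poly_four_block_zeros_col[OF E _ A3]) auto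
  moreover have "char_poly A' = [:- e, 1:] * (\<Prod>e\<leftarrow>es. [:- e, 1:])"
    using char_poly_similar[OF similar_mat_adjoint_conj[OF A W WW]] Cons.prems(3)
    by (simp add: A'_def)
  ultimately have "char_poly A3 = (\<Prod>e\<leftarrow>es. [:- e, 1:])"
    by (metis mult_cancel_left pCons_eq_0_iff zero_neq_one)
  from Cons.IH[OF A3 adjA3 this] obtain U where U: "U \<in> carrier_mat k k"
    and UU: "mat_adjoint U * U = 1\<^sub>m k" and UA: "mat_adjoint U * A3 * U = mat_diag k (\<lambda>i. es ! i)"
    by (auto simp: k_def)
  note HU = mat_adjoint_carrier[OF U]
  \<comment> \<open>The leading 1 leaves the coordinate of the split-off eigenvector alone while
    \<open>U\<close> diagonalizes the remaining block.\<close>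
  define X where "X = four_block_mat (1\<^sub>m 1) (0\<^sub>m 1 k) (0\<^sub>m k 1) U"
  have X: "X \<in> carrier_mat n n"
    using U n unfolding X_def by (metis four_block_carrier_mat one_carrier_mat plus_1_eq_Suc)
  note HX = mat_adjoint_carrier[OF X]
  have adjX: "mat_adjoint X = four_block_mat (1\<^sub>m 1) (0\<^sub>m 1 k) (0\<^sub>m k 1) (mat_adjoint U)"
    unfolding X_def by (rule mat_adjoint_one_direct_sum[OF U])
  have XX: "mat_adjoint X * X = 1\<^sub>m n"
    unfolding adjX unfolding X_def
    using U HU UU n
    by (subst mult_four_block_mat[of _ 1 1 _ k _ k _ _ 1 _ k]) auto
  have XAX: "mat_adjoint X * A' * X = mat_diag n (\<lambda>i. (e # es) ! i)"
  proof -
    have "mat_adjoint X * A' = four_block_mat E (0\<^sub>m 1 k) (0\<^sub>m k 1) (mat_adjoint U * A3)"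
      unfolding adjX blk using HU A3 E
      by (subst mult_four_block_mat[of _ 1 1 _ k _ k _ _ 1 _ k]) auto
    also have "\<dots> * X = four_block_mat E (0\<^sub>m 1 k) (0\<^sub>m k 1) (mat_adjoint U * A3 * U)"
      unfolding X_def using HU U A3 E
      by (subst mult_four_block_mat[of _ 1 1 _ k _ k _ _ 1 _ k]) auto
    also have "\<dots> = mat_diag n (\<lambda>i. (e # es) ! i)"
      unfolding UA using n
      by (intro eq_matI) (auto simp: mat_diag_def E_def nth_Cons')
    finally show ?thesis .
  qed
  have adjWX: "mat_adjoint (W * X) = mat_adjoint X * mat_adjoint W"
    by (rule mat_adjoint_mult[OF W X])
  have "mat_adjoint (W * X) * (W * X) = mat_adjoint X * (mat_adjoint W * W) * X"
    unfolding adjWX using W X H HX by (simp add: assoc_mult_mat[of _ n n _ n _ n])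
  also have "\<dots> = 1\<^sub>m n"
    using WW XX HX by simp
  finally have 1: "mat_adjoint (W * X) * (W * X) = 1\<^sub>m n" .
  have "mat_adjoint (W * X) * A * (W * X) = mat_adjoint X * A' * X"
    unfolding adjWX A'_def using W X H HX A by (simp add: assoc_mult_mat[of _ n n _ n _ n])
  with 1 XAX W X show ?case
    by (intro bexI[of _ "W * X"]) auto
qed


section \<open>Gram spectrum and right singular bases\<close>

lemma sq_vnorm_isometry:
  assumes U: "U \<in> carrier_mat m n" "mat_adjoint U * U = 1\<^sub>m n" and c: "c \<in> carrier_vec n"
  shows "sq_vnorm (U *\<^sub>v c) = sq_vnorm c"
proof -
  note H = mat_adjoint_carrier[OF U(1)]
  have Uc: "U *\<^sub>v c \<in> carrier_vec m"
    using U c by auto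
  have "(U *\<^sub>v c) \<bullet>c (U *\<^sub>v c) = c \<bullet>c c"
    using mat_adjoint_mult_vec_cscalar_prod[OF U(1) Uc c] assoc_mult_mat_vec[OF H U(1) c] U(2) c
    by simp
  then show ?thesis
    by (simp add: cscalar_prod_self)
qed

text \<open>All \<open>n\<close> square roots, without the truncation to \<open>min m n\<close> in \<open>singular_values\<close>.\<close>
definition gram_spectrum :: "complex mat \<Rightarrow> real list" where
  "gram_spectrum A = rev (sorted_list_of_multiset
     (image_mset (\<lambda>e. sqrt (Re e)) (proots (char_poly (mat_adjoint A * A)))))"

lemma singular_value_gram_spectrum:
  "j < min (dim_row A) (dim_col A) \<Longrightarrow> singular_value A (Suc j) = gram_spectrum A ! j"
  by (simp add: singular_value_def singular_values_def gram_spectrum_def)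

lemma gram_carrier:
  assumes "A \<in> carrier_mat m n"
  shows "mat_adjoint A * A \<in> carrier_mat n n"
  using assms mat_adjoint_carrier[OF assms] by auto

lemma char_poly_gram_nonzero:
  fixes A :: "complex mat"
  shows "char_poly (mat_adjoint A * A) \<noteq> 0"
  using degree_monic_char_poly[OF gram_carrier[of A "dim_row A" "dim_col A"]] by auto

lemma eigenvalue_of_gram_proot:
  fixes A :: "complex mat"
  assumes "e \<in># proots (char_poly (mat_adjoint A * A))"
  shows "eigenvalue (mat_adjoint A * A) e"
  using assms char_poly_gram_nonzero[of A]
  by (simp add: eigenvalue_root_char_poly[OF gram_carrier[of A "dim_row A" "dim_col A"]])

lemma length_gram_spectrum: "length (gram_spectrum A) = dim_col A"
proof -
  have "degree (char_poly (mat_adjoint A * A)) = dim_col A"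
    using degree_monic_char_poly[OF gram_carrier[of A "dim_row A" "dim_col A"]] by auto
  moreover have "length (sorted_list_of_multiset M) = size M" for M :: "real multiset"
    by (metis mset_sorted_list_of_multiset size_mset)
  ultimately show ?thesis
    by (simp add: gram_spectrum_def size_proots_complex)
qed

lemma gram_spectrum_antimono:
  "i \<le> j \<Longrightarrow> j < dim_col A \<Longrightarrow> gram_spectrum A ! j \<le> gram_spectrum A ! i"
  using sorted_rev_nth_mono[of "gram_spectrum A" i j] length_gram_spectrum[of A]
  by (simp add: gram_spectrum_def)

lemma gram_spectrum_nonneg:
  assumes "j < dim_col A"
  shows "0 \<le> gram_spectrum A ! j"
proof -
  have "gram_spectrum A ! j \<in> set (gram_spectrum A)"
    using assms by (simp add: length_gram_spectrum)
  then obtain e where "gram_spectrum A ! j = sqrt (Re e)"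
    and e: "e \<in># proots (char_poly (mat_adjoint A * A))"
    unfolding gram_spectrum_def by auto
  then show ?thesis
    using gram_eigenvalue_nonneg[OF eigenvalue_of_gram_proot[OF e]] by simp
qed

text \<open>The Gram eigenvalues are real and nonnegative, so squaring \<open>sqrt (Re e)\<close>
  gives back \<open>e\<close>. This supplies the ordered eigenvalue list that
  \<open>hermitian_diagonalization\<close> expects.\<close>

lemma char_poly_gram:
  "char_poly (mat_adjoint A * A) =
    (\<Prod>e\<leftarrow>map (\<lambda>x. complex_of_real (x\<^sup>2)) (gram_spectrum A). [:- e, 1:])"
proof -
  let ?p = "char_poly (mat_adjoint A * A)"
  have "lead_coeff ?p = 1"
    using degree_monic_char_poly[OF gram_carrier[of A "dim_row A" "dim_col A"]] by auto
  then have "?p = (\<Prod>e\<in>#proots ?p. [:- e, 1:])"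
    using complex_poly_decompose_multiset[of ?p] by simp
  also have "proots ?p = image_mset (\<lambda>e. complex_of_real ((sqrt (Re e))\<^sup>2)) (proots ?p)"
  proof -
    have "complex_of_real ((sqrt (Re e))\<^sup>2) = e" if "e \<in># proots ?p" for e
      using gram_eigenvalue_nonneg[OF eigenvalue_of_gram_proot[OF that]]
      by (simp add: of_real_Re del: of_real_power)
    then show ?thesis
      using image_mset_cong[of "proots ?p" "\<lambda>e. complex_of_real ((sqrt (Re e))\<^sup>2)" "\<lambda>e. e"] by simp
  qed
  also have "\<dots> = mset (map (\<lambda>x. complex_of_real (x\<^sup>2)) (gram_spectrum A))"
    by (simp add: gram_spectrum_def image_mset.compositionality o_def)
  also have "(\<Prod>e\<in>#\<dots>. [:- e, 1:]) =
      (\<Prod>e\<leftarrow>map (\<lambda>x. complex_of_real (x\<^sup>2)) (gram_spectrum A). [:- e, 1:])"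
    by (simp only: prod_mset_prod_list flip: mset_map)
  finally show ?thesis .
qed

text \<open>The columns of \<open>U\<close> are orthonormal eigenvectors of the Gram matrix, that
  is, right singular vectors of \<open>A\<close>; the left-hand side is the quadratic form of the
  diagonalized Gram matrix at \<open>c\<close>.\<close>

lemma right_singular_basis:
  assumes A: "A \<in> carrier_mat m n"
  obtains U where "U \<in> carrier_mat n n" "mat_adjoint U * U = 1\<^sub>m n"
    "\<And>c. c \<in> carrier_vec n \<Longrightarrow>
      sq_vnorm (A *\<^sub>v (U *\<^sub>v c)) = (\<Sum>i<n. (gram_spectrum A ! i)\<^sup>2 * (cmod (c $ i))\<^sup>2)"
proof -
  let ?G = "mat_adjoint A * A"
  let ?es = "map (\<lambda>x. complex_of_real (x\<^sup>2)) (gram_spectrum A)"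
  note G = gram_carrier[OF A]
  note HA = mat_adjoint_carrier[OF A]
  have len: "length (gram_spectrum A) = n"
    using A by (simp add: length_gram_spectrum)
  have "mat_adjoint ?G = ?G"
    using mat_adjoint_mult[OF HA A] by (simp add: mat_adjoint_adjoint)
  from hermitian_diagonalization[OF G this char_poly_gram] len
  obtain U where U: "U \<in> carrier_mat n n" "mat_adjoint U * U = 1\<^sub>m n"
    and D: "mat_adjoint U * ?G * U = mat_diag n (\<lambda>i. ?es ! i)"
    by auto
  note HU = mat_adjoint_carrier[OF U(1)]
  have "sq_vnorm (A *\<^sub>v (U *\<^sub>v c)) = (\<Sum>i<n. (gram_spectrum A ! i)\<^sup>2 * (cmod (c $ i))\<^sup>2)"
    if c: "c \<in> carrier_vec n" for c
  proof -
    have Uc: "U *\<^sub>v c \<in> carrier_vec n"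
      using U c by auto
    have AUc: "A *\<^sub>v (U *\<^sub>v c) \<in> carrier_vec m"
      using A Uc by auto
    have "complex_of_real (sq_vnorm (A *\<^sub>v (U *\<^sub>v c))) =
        (mat_adjoint A *\<^sub>v (A *\<^sub>v (U *\<^sub>v c))) \<bullet>c (U *\<^sub>v c)"
      by (simp add: mat_adjoint_mult_vec_cscalar_prod[OF A AUc Uc] cscalar_prod_self)
    also have "\<dots> = (mat_adjoint U *\<^sub>v (mat_adjoint A *\<^sub>v (A *\<^sub>v (U *\<^sub>v c)))) \<bullet>c c"
      using HA AUc by (intro mat_adjoint_mult_vec_cscalar_prod[OF U(1) _ c, symmetric]) auto
    also have "mat_adjoint U *\<^sub>v (mat_adjoint A *\<^sub>v (A *\<^sub>v (U *\<^sub>v c))) = (mat_adjoint U * ?G * U) *\<^sub>v c"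
      using A HA U HU c Uc G
      by (simp add: assoc_mult_mat_vec[of _ n n _ n] assoc_mult_mat_vec[OF HA A Uc])
    also have "\<dots> \<bullet>c c = (\<Sum>i<n. (?es ! i * c $ i) * cnj (c $ i))"
      unfolding D using c
      by (auto simp: scalar_prod_def mat_diag_def atLeast0LessThan if_distrib[of "\<lambda>x. x * _"]
          sum.delta' cong: if_cong intro!: sum.cong)
    also have "\<dots> = complex_of_real (\<Sum>i<n. (gram_spectrum A ! i)\<^sup>2 * (cmod (c $ i))\<^sup>2)"
      using len by (simp add: complex_norm_square mult.assoc del: of_real_power)
    finally show ?thesis
      by (simp only: of_real_eq_iff)
  qed
  with U that show ?thesis
    by blast
qed

section \<open>Comparison of singular values\<close>

text \<open>The conditions on \<open>c\<close> are \<open>n - 1\<close> homogeneous linear equations; written as a square system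
  they leave row \<open>k\<close> zero.\<close>
lemma exists_vec_in_complementary_flags:
  fixes M :: "'a :: field mat"
  assumes M: "M \<in> carrier_mat n n" and k: "k < n"
  obtains c where "c \<in> carrier_vec n" "c \<noteq> 0\<^sub>v n"
    "\<And>i. k < i \<Longrightarrow> i < n \<Longrightarrow> c $ i = 0" "\<And>i. i < k \<Longrightarrow> (M *\<^sub>v c) $ i = 0"
proof -
  define R where "R = mat\<^sub>r n n
    (\<lambda>i. if i = k then 0\<^sub>v n else if i < k then row M i else unit_vec n i)"
  have "det R = 0"
    unfolding R_def using M by (intro det_row_0[OF k]) auto
  moreover have R: "R \<in> carrier_mat n n"
    by (simp add: R_def)
  ultimately obtain c where c: "c \<in> carrier_vec n" "c \<noteq> 0\<^sub>v n" and Rc: "R *\<^sub>v c = 0\<^sub>v n"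
    by (auto simp: det_0_iff_vec_prod_zero[OF R])
  have row: "row R i \<bullet> c = 0" if "i < n" for i
    using arg_cong[OF Rc, of "\<lambda>w. w $ i"] that R by simp
  have "c $ i = 0" if "k < i" "i < n" for i
    using row[of i] that c(1) by (simp add: R_def)
  moreover have "(M *\<^sub>v c) $ i = 0" if "i < k" for i
    using row[of i] that k M by (simp add: R_def)
  ultimately show ?thesis
    using that c by blast
qed

text \<open>A Courant-Fischer argument: the span of the columns \<open>0..k\<close> of
  \<open>U\<close> and that of the columns \<open>k..n-1\<close> of \<open>V\<close> have dimensions
  adding up to \<open>n + 1\<close>, so they share a non-zero vector, at which the two quadratic
  forms are compared.\<close>

lemma gram_spectrum_mono:
  assumes A: "A \<in> carrier_mat m n" and B: "B \<in> carrier_mat m' n" and t: "0 \<le> t"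
    and le: "\<And>x. x \<in> carrier_vec n \<Longrightarrow> sq_vnorm (A *\<^sub>v x) \<le> t\<^sup>2 * sq_vnorm (B *\<^sub>v x)"
    and k: "k < n"
  shows "gram_spectrum A ! k \<le> t * gram_spectrum B ! k"
proof -
  obtain U where U: "U \<in> carrier_mat n n" "mat_adjoint U * U = 1\<^sub>m n"
    and AU: "\<And>c. c \<in> carrier_vec n \<Longrightarrow>
      sq_vnorm (A *\<^sub>v (U *\<^sub>v c)) = (\<Sum>i<n. (gram_spectrum A ! i)\<^sup>2 * (cmod (c $ i))\<^sup>2)"
    using right_singular_basis[OF A] by blast
  obtain V where V: "V \<in> carrier_mat n n" "mat_adjoint V * V = 1\<^sub>m n"
    and BV: "\<And>c. c \<in> carrier_vec n \<Longrightarrow>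
      sq_vnorm (B *\<^sub>v (V *\<^sub>v c)) = (\<Sum>i<n. (gram_spectrum B ! i)\<^sup>2 * (cmod (c $ i))\<^sup>2)"
    using right_singular_basis[OF B] by blast
  note H = mat_adjoint_carrier[OF V(1)]
  note VV = mat_mult_left_right_inverse[OF H V(1,2)]
  let ?a = "gram_spectrum A" and ?b = "gram_spectrum B"
  have M: "mat_adjoint V * U \<in> carrier_mat n n"
    using H U by auto
  obtain c where c: "c \<in> carrier_vec n" "c \<noteq> 0\<^sub>v n"
    and c0: "\<And>i. k < i \<Longrightarrow> i < n \<Longrightarrow> c $ i = 0"
    and d0: "\<And>i. i < k \<Longrightarrow> (mat_adjoint V * U *\<^sub>v c) $ i = 0"
    using exists_vec_in_complementary_flags[OF M k] by blast
  \<comment> \<open>\<open>c\<close> and \<open>d\<close> are the coordinates of one vector in the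
    bases formed by the columns of \<open>U\<close> and of \<open>V\<close>.\<close>
  define d where "d = mat_adjoint V * U *\<^sub>v c"
  have d: "d \<in> carrier_vec n"
    using M c by (auto simp: d_def)
  have Uc: "U *\<^sub>v c \<in> carrier_vec n"
    using U c by auto
  have "V *\<^sub>v d = V * mat_adjoint V *\<^sub>v (U *\<^sub>v c)"
    using V H U c Uc by (simp add: d_def assoc_mult_mat_vec[of _ n n _ n])
  then have Vd: "V *\<^sub>v d = U *\<^sub>v c"
    using VV Uc by simp
  have cd: "sq_vnorm c = sq_vnorm d"
    using sq_vnorm_isometry[OF U c(1)] sq_vnorm_isometry[OF V d] Vd by simp
  have pos: "0 < sq_vnorm d"
    using sq_vnorm_pos[OF c] cd by simp
  \<comment> \<open>Only indices up to \<open>k\<close> contribute, and their weights are at least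
    the \<open>k\<close>-th one.\<close>
  have "(?a ! k)\<^sup>2 * sq_vnorm c \<le> sq_vnorm (A *\<^sub>v (U *\<^sub>v c))"
    unfolding AU[OF c(1)] sq_vnorm_carrier[OF c(1)] sum_distrib_left
  proof (intro sum_mono)
    fix i assume i: "i \<in> {..<n}"
    show "(?a ! k)\<^sup>2 * (cmod (c $ i))\<^sup>2 \<le> (?a ! i)\<^sup>2 * (cmod (c $ i))\<^sup>2"
    proof (cases "i \<le> k")
      case True
      then show ?thesis
        using gram_spectrum_antimono[of i k A] gram_spectrum_nonneg[of k A] k A
        by (intro mult_right_mono power_mono) auto
    qed (use c0[of i] i in auto)
  qed
  also have "\<dots> \<le> t\<^sup>2 * sq_vnorm (B *\<^sub>v (V *\<^sub>v d))"
    unfolding Vd by (rule le[OF Uc])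
  \<comment> \<open>Here only indices from \<open>k\<close> on contribute, and their weights are at
    most the \<open>k\<close>-th one.\<close>
  also have "\<dots> \<le> t\<^sup>2 * ((?b ! k)\<^sup>2 * sq_vnorm d)"
    unfolding BV[OF d] sq_vnorm_carrier[OF d] sum_distrib_left
  proof (intro sum_mono)
    fix i assume i: "i \<in> {..<n}"
    show "t\<^sup>2 * ((?b ! i)\<^sup>2 * (cmod (d $ i))\<^sup>2) \<le> t\<^sup>2 * ((?b ! k)\<^sup>2 * (cmod (d $ i))\<^sup>2)"
    proof (cases "i < k")
      case False
      then show ?thesis
        using gram_spectrum_antimono[of k i B] gram_spectrum_nonneg[of i B] i B
        by (intro mult_left_mono mult_right_mono power_mono) auto
    qed (use d0[of i] in \<open>auto simp: d_def\<close>)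
  qed
  \<comment> \<open>Both coordinate vectors have the same positive norm, which cancels.\<close>
  finally have "(?a ! k)\<^sup>2 \<le> (t * ?b ! k)\<^sup>2"
    using pos by (simp add: cd power_mult_distrib flip: mult.assoc)
  moreover have "0 \<le> t * ?b ! k"
    using t gram_spectrum_nonneg[of k B] k B by simp
  ultimately show ?thesis
    by (rule power2_le_imp_le)
qed

section \<open>The two-norm and singular values of products\<close>

lemma two_norm_eq:
  assumes "A \<in> carrier_mat m n" "0 < m" "0 < n"
  shows "two_norm A = gram_spectrum A ! 0"
  using assms singular_value_gram_spectrum[of 0 A] by (simp add: two_norm_def)

text \<open>In right singular coordinates the squared norm of the image is a weighted sum in which
  the first weight is the largest.\<close>

lemma sq_vnorm_mult_vec_le:
  assumes A: "A \<in> carrier_mat m n" and mn: "0 < m" "0 < n" and x: "x \<in> carrier_vec n"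
  shows "sq_vnorm (A *\<^sub>v x) \<le> (two_norm A)\<^sup>2 * sq_vnorm x"
proof -
  obtain U where U: "U \<in> carrier_mat n n" "mat_adjoint U * U = 1\<^sub>m n"
    and AU: "\<And>c. c \<in> carrier_vec n \<Longrightarrow>
      sq_vnorm (A *\<^sub>v (U *\<^sub>v c)) = (\<Sum>i<n. (gram_spectrum A ! i)\<^sup>2 * (cmod (c $ i))\<^sup>2)"
    using right_singular_basis[OF A] by blast
  note H = mat_adjoint_carrier[OF U(1)]
  define c where "c = mat_adjoint U *\<^sub>v x"
  have c: "c \<in> carrier_vec n"
    using H x by (auto simp: c_def)
  have "U *\<^sub>v c = U * mat_adjoint U *\<^sub>v x"
    unfolding c_def using assoc_mult_mat_vec[OF U(1) H x] by simp
  then have Uc: "U *\<^sub>v c = x"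
    using mat_mult_left_right_inverse[OF H U] x by simp
  have "sq_vnorm (A *\<^sub>v x) \<le> (gram_spectrum A ! 0)\<^sup>2 * sq_vnorm c"
    unfolding Uc[symmetric] AU[OF c] sq_vnorm_carrier[OF c] sum_distrib_left
    using gram_spectrum_antimono[of 0 _ A] gram_spectrum_nonneg[of _ A] A
    by (intro sum_mono mult_right_mono power_mono) auto
  then show ?thesis
    using sq_vnorm_isometry[OF U c] Uc two_norm_eq[OF A mn] by simp
qed

lemma two_norm_nonneg:
  assumes "A \<in> carrier_mat m n" "0 < m" "0 < n"
  shows "0 \<le> two_norm A"
  using two_norm_eq[OF assms] gram_spectrum_nonneg[of 0 A] assms by simp

text \<open>If the two-norm vanished, \<open>A\<close> would annihilate all unit vectors, whose
  images are its columns.\<close>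

lemma two_norm_pos:
  assumes A: "A \<in> carrier_mat m n" and nz: "A \<noteq> 0\<^sub>m m n"
  shows "0 < two_norm A"
proof (rule ccontr)
  assume neg: "\<not> 0 < two_norm A"
  \<comment> \<open>A matrix without rows or columns equals the zero matrix, so here
    \<open>two_norm\<close> is an actual singular value.\<close>
  have mn: "0 < m" "0 < n"
    using A nz by (auto intro!: gr0I eq_matI)
  have "two_norm A = 0"
    using two_norm_nonneg[OF A mn] neg by simp
  then have "sq_vnorm (A *\<^sub>v x) = 0" if "x \<in> carrier_vec n" for x
    using sq_vnorm_mult_vec_le[OF A mn that] sq_vnorm_nonneg[of "A *\<^sub>v x"] by simp
  then have Ax: "A *\<^sub>v x = 0\<^sub>v m" if "x \<in> carrier_vec n" for x
    using that A sq_vnorm_eq_0[of "A *\<^sub>v x" m] by auto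
  have "A = 0\<^sub>m m n"
  proof (rule eq_matI)
    fix i j assume ij: "i < dim_row (0\<^sub>m m n)" "j < dim_col (0\<^sub>m m n)"
    then have "(A *\<^sub>v unit_vec n j) $ i = A $$ (i, j)"
      using A by simp
    then show "A $$ (i, j) = 0\<^sub>m m n $$ (i, j)"
      using ij Ax[of "unit_vec n j"] by simp
  qed (use A in auto)
  with nz show False ..
qed

text \<open>The operator bound for \<open>A\<close> at the vector \<open>B x\<close> is the
  domination hypothesis of \<open>gram_spectrum_mono\<close> with \<open>t = two_norm A\<close>. The
  bounds on \<open>j\<close> keep the index inside both truncated lists.\<close>

lemma singular_value_mult_le:
  assumes A: "A \<in> carrier_mat l m" and B: "B \<in> carrier_mat m n"
    and j: "j < l" "j < m" "j < n"
  shows "singular_value (A * B) (Suc j) \<le> two_norm A * singular_value B (Suc j)"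
proof -
  have AB: "A * B \<in> carrier_mat l n"
    using A B by auto
  have lm: "0 < l" "0 < m"
    using j by auto
  have "gram_spectrum (A * B) ! j \<le> two_norm A * gram_spectrum B ! j"
  proof (rule gram_spectrum_mono[OF AB B two_norm_nonneg[OF A lm] _ j(3)])
    fix x :: "complex vec" assume x: "x \<in> carrier_vec n"
    show "sq_vnorm (A * B *\<^sub>v x) \<le> (two_norm A)\<^sup>2 * sq_vnorm (B *\<^sub>v x)"
      unfolding assoc_mult_mat_vec[OF A B x] using B x by (intro sq_vnorm_mult_vec_le[OF A lm]) auto
  qed
  then show ?thesis
    using A B j by (simp add: singular_value_gram_spectrum)
qed

lemma singular_value_nonneg:
  "j < min (dim_row A) (dim_col A) \<Longrightarrow> 0 \<le> singular_value A (Suc j)"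
  using gram_spectrum_nonneg[of j A] by (simp add: singular_value_gram_spectrum)

section \<open>Stable ranks\<close>

lemma schatten_norm_powr:
  assumes "A \<in> carrier_mat m n" "p \<noteq> 0"
  shows "schatten_norm p A powr p = (\<Sum>j<min m n. singular_value A (Suc j) powr p)"
proof -
  have "schatten_norm p A = (\<Sum>j<min m n. singular_value A (Suc j) powr p) powr (1 / p)"
    using assms(1) by (simp add: schatten_norm_def sum.atLeast1_atMost_eq)
  then show ?thesis
    using assms(2) by (simp add: powr_powr sum_nonneg)
qed

lemma stable_rank_nonneg: "0 \<le> stable_rank p A"
  by (simp add: stable_rank_def)

text \<open>\<open>two_norm A\<close> limits the growth of the numerator and
  \<open>two_norm C\<close> the decrease of the denominator. With the inverse as an explicit
  \<open>C\<close>, the lemma also applies with \<open>A\<close> and \<open>C\<close>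
  exchanged.\<close>

lemma stable_rank_mult_le:
  assumes p: "0 < p" and A: "A \<in> carrier_mat m m" and C: "C \<in> carrier_mat m m"
    and CA: "C * A = 1\<^sub>m m" and B: "B \<in> carrier_mat m n"
  shows "stable_rank p (A * B) \<le> (two_norm A * two_norm C) powr p * stable_rank p B"
proof (cases "B = 0\<^sub>m m n")
  \<comment> \<open>Both sides are 0 by the convention for the zero matrix.\<close>
  case True
  with A B show ?thesis
    by (simp add: stable_rank_def)
next
  case False
  have AB: "A * B \<in> carrier_mat m n"
    using A B by auto
  have CAB: "C * (A * B) = B"
    using assoc_mult_mat[OF C A B] CA B by simp
  have ABnz: "A * B \<noteq> 0\<^sub>m m n"
    using CAB C False by auto
  have mn: "0 < m" "0 < n"
    using B False by (auto intro!: gr0I eq_matI)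
  note bpos = two_norm_pos[OF B False] and abpos = two_norm_pos[OF AB ABnz]
  note Ann = two_norm_nonneg[OF A mn(1,1)] and Cnn = two_norm_nonneg[OF C mn(1,1)]
  let ?S = "\<lambda>X. \<Sum>j<min m n. singular_value X (Suc j) powr p"
  have sr: "stable_rank p X = ?S X / two_norm X powr p"
    if "X \<in> carrier_mat m n" "X \<noteq> 0\<^sub>m m n" for X
    using that p by (simp add: stable_rank_def schatten_norm_powr)
  have "?S (A * B) \<le> (\<Sum>j<min m n. (two_norm A * singular_value B (Suc j)) powr p)"
    using singular_value_mult_le[OF A B] singular_value_nonneg[of _ "A * B"] A B p
    by (intro sum_mono powr_mono2) auto
  also have "\<dots> = two_norm A powr p * ?S B"
    using singular_value_nonneg[of _ B] B Ann by (simp add: powr_mult sum_distrib_left)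
  finally have num: "?S (A * B) \<le> two_norm A powr p * ?S B" .
  \<comment> \<open>The largest singular value, at index 0, of the product
    \<open>B = C * (A * B)\<close>.\<close>
  have "two_norm B \<le> two_norm C * two_norm (A * B)"
    using singular_value_mult_le[OF C AB, of 0] mn unfolding CAB by (simp add: two_norm_def)
  then have "two_norm B powr p \<le> two_norm C powr p * two_norm (A * B) powr p"
    using bpos abpos Cnn p powr_mono2[of p "two_norm B" "two_norm C * two_norm (A * B)"]
    by (simp add: powr_mult)
  then have den: "1 / two_norm (A * B) powr p \<le> two_norm C powr p / two_norm B powr p"
    using bpos abpos by (simp add: field_simps)
  have "?S (A * B) * (1 / two_norm (A * B) powr p) \<le>
      (two_norm A powr p * ?S B) * (two_norm C powr p / two_norm B powr p)"
    using num den by (intro mult_mono) (auto intro!: mult_nonneg_nonneg sum_nonneg)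
  then show ?thesis
    using sr[OF AB ABnz] sr[OF B False] Ann Cnn by (simp add: powr_mult mult_ac)
qed

theorem theorem5p15:
  fixes p :: real and m n :: nat and A B :: "complex mat"
  assumes "1 \<le> p"
    and "A \<in> carrier_mat m m" and "invertible_mat A"
    and "B \<in> carrier_mat m n"
  shows "stable_rank p B / cond_number A powr p \<le> stable_rank p (A * B) \<and>
         stable_rank p (A * B) \<le> cond_number A powr p * stable_rank p B"
proof -
  note A = assms(2) and B = assms(4)
  have p: "0 < p"
    using assms(1) by simp
  obtain D where D: "A * D = 1\<^sub>m m" "D * A = 1\<^sub>m (dim_row D)"
    using assms(2,3) unfolding invertible_mat_def inverts_mat_def by auto
  \<comment> \<open>Invertibility supplies \<open>D\<close> without dimensions; comparing column
    counts in the two identities gives them.\<close>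
  have "D \<in> carrier_mat m m"
    using A arg_cong[OF D(1), of dim_col] arg_cong[OF D(2), of dim_col] by auto
  \<comment> \<open>\<open>mat_inverse\<close> returns \<open>None\<close> only for non-units of the
    matrix ring, so the abstract inverse \<open>D\<close> forces it to return a matrix.\<close>
  with A D have "A \<in> Units (ring_mat TYPE(complex) m ())"
    unfolding Units_def ring_mat_def by auto
  then obtain C where C: "mat_inverse A = Some C"
    using mat_inverse(1)[OF A, of "()"] by blast
  with mat_inverse(2)[OF A] have AC: "A * C = 1\<^sub>m m" "C * A = 1\<^sub>m m" and Cc: "C \<in> carrier_mat m m"
    by auto
  have cond: "cond_number A = two_norm A * two_norm C"
    by (simp add: cond_number_def C)
  have AB: "A * B \<in> carrier_mat m n"
    using A B by auto
  have "C * (A * B) = B"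
    using assoc_mult_mat[OF Cc A B] AC B by simp
  \<comment> \<open>The roles are exchanged: \<open>C\<close> multiplies \<open>A * B\<close>, and
    its inverse is \<open>A\<close>.\<close>
  with stable_rank_mult_le[OF p Cc A AC(1) AB]
  have "stable_rank p B \<le> cond_number A powr p * stable_rank p (A * B)"
    by (simp add: cond mult.commute)
  \<comment> \<open>Should the denominator be 0, the quotient is 0 and nonnegativity of the stable
    rank suffices.\<close>
  then have "stable_rank p B / cond_number A powr p \<le> stable_rank p (A * B)"
    by (auto simp: divide_le_eq mult.commute stable_rank_nonneg)
  with stable_rank_mult_le[OF p A Cc AC(2) B] show ?thesis
    by (simp add: cond)
qed

end
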